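(* Let $\beta_1,\beta_3,\kappa_1,\kappa_2>0$ and $\alpha_1,\alpha_2,\alpha_3,\alpha_4\ge 0$ be constants with $(\alpha_3-\alpha_4)\beta_1+(\alpha_3+\alpha_4\beta_1\kappa_2)\alpha_2\neq 0$, let $d_1=1$, $d_3=1$, and suppose that $$\alpha_1=\beta_1-24,\quad \kappa_1=\frac{24\alpha_2\kappa_2+23\beta_1-(\beta_1-24+24\alpha_2)\beta_1\kappa_2}{(\alpha_3-\alpha_4)\beta_1+(\alpha_3+\alpha_4\beta_1\kappa_2)\alpha_2},$$ $$\beta_3=\frac{(\alpha_3-\alpha_4-24)\beta_1-24\kappa_2\alpha_2^2+(\alpha_3+\alpha_4\beta_1\kappa_2)\alpha_2}{\beta_1+\kappa_2\alpha_2^2}.$$ Then the functions $$u(t,x)=\frac{\beta_1+\alpha_2}{4(\beta_1+\kappa_2\alpha_2^2)}\big(1-\tanh(x-10t)\big)^2,\quad v(t,x)=\frac{\beta_1(1-\kappa_2\alpha_2)}{4(\beta_1+\kappa_2\alpha_2^2)}\big(1-\tanh(x-10t)\big)^2,$$ $$w(t,x)=1-\frac14\big(1-\tanh(x-10t)\big)^2$$ form an exact solution, for all $(t,x)\in\mathbb{R}^2$, of the system $$u_t = d_1u_{xx}+\beta_1u(1-u)-\alpha_1uw+\alpha_2uv,$$ $$v_t = v_{xx}+ v(1-v)+(\kappa_1\alpha_3+\kappa_2\alpha_1)uw-(\kappa_2\alpha_2u+\kappa_1\alpha_4w)v,$$ $$w_t = d_3 w_{xx}+\beta_3w(1-w)-\alpha_3uw+\alpha_4vw.$$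 *)

theory Defs
  imports "HOL-Analysis.Analysis"
begin

text \<open>
  Functions of time and space are curried, \<open>u t x\<close>, with \<open>t\<close> the time variable.
\<close>

definition time_deriv :: "(real \<Rightarrow> real \<Rightarrow> real) \<Rightarrow> real \<Rightarrow> real \<Rightarrow> real" where
  "time_deriv u t x = deriv (\<lambda>s. u s x) t"

definition space_deriv :: "(real \<Rightarrow> real \<Rightarrow> real) \<Rightarrow> real \<Rightarrow> real \<Rightarrow> real" where
  "space_deriv u t x = deriv (\<lambda>y. u t y) x"

text \<open>
  The regularity of a classical solution of a second-order parabolic equation on the whole
  plane (class \<open>C\<close> with indices 1 in \<open>t\<close> and 2 in \<open>x\<close>). As \<open>deriv\<close> is a
  total function, differentiability has to be demanded explicitly.
\<close>

definition classically_regular :: "(real \<Rightarrow> real \<Rightarrow> real) \<Rightarrow> bool" where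
  "classically_regular u \<longleftrightarrow>
     (\<forall>t x. (\<lambda>s. u s x) field_differentiable at t) \<and>
     (\<forall>t x. (\<lambda>y. u t y) field_differentiable at x) \<and>
     (\<forall>t x. (\<lambda>y. space_deriv u t y) field_differentiable at x) \<and>
     continuous_on UNIV (\<lambda>(t, x). u t x) \<and>
     continuous_on UNIV (\<lambda>(t, x). time_deriv u t x) \<and>
     continuous_on UNIV (\<lambda>(t, x). space_deriv u t x) \<and>
     continuous_on UNIV (\<lambda>(t, x). space_deriv (space_deriv u) t x)"

end

(*
  All three functions are affine in \<phi> = (1 - tanh (x - 10 t))\<^sup>2 / 4, and \<phi> solves the
  Fisher equation \<phi>\<^sub>t = \<phi>\<^sub>x\<^sub>x + 24 \<phi> (1 - \<phi>). Substituting u = A \<phi>, v = B \<phi>, w = 1 - \<phi>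
  and comparing powers of \<phi>, the system reduces to four relations between the coefficients:
  \<beta>\<^sub>1 A - \<alpha>\<^sub>2 B = \<beta>\<^sub>1, B + \<kappa>\<^sub>2 \<alpha>\<^sub>2 A = 1,
  \<kappa>\<^sub>1 (\<alpha>\<^sub>3 A - \<alpha>\<^sub>4 B) = 23 B - \<kappa>\<^sub>2 \<alpha>\<^sub>1 A and \<beta>\<^sub>3 = \<alpha>\<^sub>3 A - \<alpha>\<^sub>4 B - 24.
*)

theory Submission imports Defs
begin

text \<open>This is the explicit Ablowitz-Zeppetella front of the Fisher equation, rescaled to
  growth rate 24: its speed is 5 * sqrt (24 / 6) = 10.\<close>

definition tanh_front :: "real \<Rightarrow> real \<Rightarrow> real" where
  "tanh_front t x = (1 - tanh (x - 10 * t))^2 / 4"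

text \<open>The affine form with free \<open>a\<close> and \<open>b\<close> lets one computation
  serve all three components: \<open>(a, b)\<close> will be \<open>(0, A)\<close>,
  \<open>(0, B)\<close> and \<open>(1, - 1)\<close>.\<close>

lemma tanh_front_has_time_derivative:
  "((\<lambda>s. a + b * tanh_front s x) has_field_derivative
     b * (5 * (1 - tanh (x - 10 * t)) * (1 - tanh (x - 10 * t) ^ 2))) (at t)"
  unfolding tanh_front_def
  by (auto intro!: derivative_eq_intros simp: field_simps power2_eq_square)

lemma tanh_front_has_space_derivative:
  "((\<lambda>y. a + b * tanh_front t y) has_field_derivative
     b * (- (1 - tanh (x - 10 * t)) * (1 - tanh (x - 10 * t) ^ 2) / 2)) (at x)"
  unfolding tanh_front_def
  by (auto intro!: derivative_eq_intros simp: field_simps power2_eq_square)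

lemma time_deriv_tanh_front:
  "time_deriv (\<lambda>t x. a + b * tanh_front t x) =
     (\<lambda>t x. b * (5 * (1 - tanh (x - 10 * t)) * (1 - tanh (x - 10 * t) ^ 2)))"
  unfolding time_deriv_def
  by (intro ext DERIV_imp_deriv tanh_front_has_time_derivative)

lemma space_deriv_tanh_front:
  "space_deriv (\<lambda>t x. a + b * tanh_front t x) =
     (\<lambda>t x. b * (- (1 - tanh (x - 10 * t)) * (1 - tanh (x - 10 * t) ^ 2) / 2))"
  unfolding space_deriv_def
  by (intro ext DERIV_imp_deriv tanh_front_has_space_derivative)

lemma space_deriv_tanh_front_has_space_derivative:
  "(space_deriv (\<lambda>t x. a + b * tanh_front t x) t has_field_derivative
     b * ((1 - tanh (x - 10 * t) ^ 2) *
       ((1 - tanh (x - 10 * t) ^ 2) / 2 + tanh (x - 10 * t) * (1 - tanh (x - 10 * t))))) (at x)"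
  unfolding space_deriv_tanh_front
  by (auto intro!: derivative_eq_intros simp: field_simps power2_eq_square)

lemma space_deriv2_tanh_front:
  "space_deriv (space_deriv (\<lambda>t x. a + b * tanh_front t x)) =
     (\<lambda>t x. b * ((1 - tanh (x - 10 * t) ^ 2) *
       ((1 - tanh (x - 10 * t) ^ 2) / 2 + tanh (x - 10 * t) * (1 - tanh (x - 10 * t)))))"
  \<comment> \<open>The instantiation unfolds only the outer derivative; the inner one has to stay
    folded to match the preceding lemma.\<close>
  unfolding space_deriv_def[of "space_deriv _"]
  by (intro ext DERIV_imp_deriv space_deriv_tanh_front_has_space_derivative)

lemma classically_regular_tanh_front:
  "classically_regular (\<lambda>t x. a + b * tanh_front t x)"
  unfolding classically_regular_def
proof (intro conjI allI)
  fix t x :: real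
  show "(\<lambda>s. a + b * tanh_front s x) field_differentiable at t"
    using tanh_front_has_time_derivative field_differentiable_def by blast
  show "(\<lambda>y. a + b * tanh_front t y) field_differentiable at x"
    using tanh_front_has_space_derivative field_differentiable_def by blast
  show "space_deriv (\<lambda>t x. a + b * tanh_front t x) t field_differentiable at x"
    using space_deriv_tanh_front_has_space_derivative field_differentiable_def by blast
\<comment> \<open>Only the continuity claims remain. The second derivative is rewritten first, since
  rewriting the inner \<open>space_deriv\<close> would destroy its pattern.\<close>
qed (unfold time_deriv_tanh_front space_deriv2_tanh_front, unfold space_deriv_tanh_front,
     auto simp: tanh_front_def case_prod_unfold intro!: continuous_intros)

text \<open>As tanh' = 1 - tanh^2, both sides are polynomials in T = tanh (x - 10 * t). After
  removing the common factor \<open>b\<close> * (1 - T)^2 * (1 + T), what is left is 5 = (1 + 3 * T)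
  / 2 + 3 * (3 - T) / 2.\<close>

lemma tanh_front_Fisher_equation:
  "time_deriv (\<lambda>t x. a + b * tanh_front t x) t x =
     space_deriv (space_deriv (\<lambda>t x. a + b * tanh_front t x)) t x
       + 24 * b * tanh_front t x * (1 - tanh_front t x)"
  unfolding time_deriv_tanh_front space_deriv2_tanh_front unfolding tanh_front_def
  by (simp add: field_simps power2_eq_square)

theorem mainTheorem3:
  fixes \<alpha>\<^sub>1 \<alpha>\<^sub>2 \<alpha>\<^sub>3 \<alpha>\<^sub>4 \<beta>\<^sub>1 \<beta>\<^sub>3 \<kappa>\<^sub>1 \<kappa>\<^sub>2 d\<^sub>1 d\<^sub>3 :: real
    and u v w :: "real \<Rightarrow> real \<Rightarrow> real"
  assumes "\<beta>\<^sub>1 > 0" and "\<beta>\<^sub>3 > 0" and "\<kappa>\<^sub>1 > 0" and "\<kappa>\<^sub>2 > 0"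
    and "\<alpha>\<^sub>1 \<ge> 0" and "\<alpha>\<^sub>2 \<ge> 0" and "\<alpha>\<^sub>3 \<ge> 0" and "\<alpha>\<^sub>4 \<ge> 0"
    and "(\<alpha>\<^sub>3 - \<alpha>\<^sub>4) * \<beta>\<^sub>1 + (\<alpha>\<^sub>3 + \<alpha>\<^sub>4 * \<beta>\<^sub>1 * \<kappa>\<^sub>2) * \<alpha>\<^sub>2 \<noteq> 0"
    and "d\<^sub>1 = 1" and "d\<^sub>3 = 1"
    and "\<alpha>\<^sub>1 = \<beta>\<^sub>1 - 24"
    and "\<kappa>\<^sub>1 = (24 * \<alpha>\<^sub>2 * \<kappa>\<^sub>2 + 23 * \<beta>\<^sub>1 - (\<beta>\<^sub>1 - 24 + 24 * \<alpha>\<^sub>2) * \<beta>\<^sub>1 * \<kappa>\<^sub>2)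
               / ((\<alpha>\<^sub>3 - \<alpha>\<^sub>4) * \<beta>\<^sub>1 + (\<alpha>\<^sub>3 + \<alpha>\<^sub>4 * \<beta>\<^sub>1 * \<kappa>\<^sub>2) * \<alpha>\<^sub>2)"
    and "\<beta>\<^sub>3 = ((\<alpha>\<^sub>3 - \<alpha>\<^sub>4 - 24) * \<beta>\<^sub>1 - 24 * \<kappa>\<^sub>2 * \<alpha>\<^sub>2^2 + (\<alpha>\<^sub>3 + \<alpha>\<^sub>4 * \<beta>\<^sub>1 * \<kappa>\<^sub>2) * \<alpha>\<^sub>2)
               / (\<beta>\<^sub>1 + \<kappa>\<^sub>2 * \<alpha>\<^sub>2^2)"
    and "u = (\<lambda>t x. (\<beta>\<^sub>1 + \<alpha>\<^sub>2) / (4 * (\<beta>\<^sub>1 + \<kappa>\<^sub>2 * \<alpha>\<^sub>2^2)) * (1 - tanh (x - 10 * t))^2)"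
    and "v = (\<lambda>t x. \<beta>\<^sub>1 * (1 - \<kappa>\<^sub>2 * \<alpha>\<^sub>2) / (4 * (\<beta>\<^sub>1 + \<kappa>\<^sub>2 * \<alpha>\<^sub>2^2)) * (1 - tanh (x - 10 * t))^2)"
    and "w = (\<lambda>t x. 1 - 1 / 4 * (1 - tanh (x - 10 * t))^2)"
  shows "classically_regular u \<and> classically_regular v \<and> classically_regular w \<and>
    (\<forall>t x.
      time_deriv u t x = d\<^sub>1 * space_deriv (space_deriv u) t x
        + \<beta>\<^sub>1 * u t x * (1 - u t x) - \<alpha>\<^sub>1 * u t x * w t x + \<alpha>\<^sub>2 * u t x * v t x \<and>
      time_deriv v t x = space_deriv (space_deriv v) t x
        + v t x * (1 - v t x) + (\<kappa>\<^sub>1 * \<alpha>\<^sub>3 + \<kappa>\<^sub>2 * \<alpha>\<^sub>1) * u t x * w t x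
        - (\<kappa>\<^sub>2 * \<alpha>\<^sub>2 * u t x + \<kappa>\<^sub>1 * \<alpha>\<^sub>4 * w t x) * v t x \<and>
      time_deriv w t x = d\<^sub>3 * space_deriv (space_deriv w) t x
        + \<beta>\<^sub>3 * w t x * (1 - w t x) - \<alpha>\<^sub>3 * u t x * w t x + \<alpha>\<^sub>4 * v t x * w t x)"
proof -
  define D where "D = \<beta>\<^sub>1 + \<kappa>\<^sub>2 * \<alpha>\<^sub>2^2"
  define A where "A = (\<beta>\<^sub>1 + \<alpha>\<^sub>2) / D"
  define B where "B = \<beta>\<^sub>1 * (1 - \<kappa>\<^sub>2 * \<alpha>\<^sub>2) / D"
  define E where "E = (\<alpha>\<^sub>3 - \<alpha>\<^sub>4) * \<beta>\<^sub>1 + (\<alpha>\<^sub>3 + \<alpha>\<^sub>4 * \<beta>\<^sub>1 * \<kappa>\<^sub>2) * \<alpha>\<^sub>2"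
  have "D > 0"
    unfolding D_def using assms(1,4) by (simp add: add_pos_nonneg)
  \<comment> \<open>With the denominator cleared, each relation between coefficients becomes a
    polynomial identity after multiplication by \<open>D\<close>, which is then cancelled.\<close>
  have AD: "A * D = \<beta>\<^sub>1 + \<alpha>\<^sub>2" and BD: "B * D = \<beta>\<^sub>1 * (1 - \<kappa>\<^sub>2 * \<alpha>\<^sub>2)"
    using \<open>D > 0\<close> by (simp_all add: A_def B_def)
  \<comment> \<open>The redundant \<open>0 +\<close> and \<open>(- 1) *\<close> make the components
    match \<open>a + b * tanh_front t x\<close> literally.\<close>
  have u: "u = (\<lambda>t x. 0 + A * tanh_front t x)"
    and v: "v = (\<lambda>t x. 0 + B * tanh_front t x)"
    and w: "w = (\<lambda>t x. 1 + (- 1) * tanh_front t x)"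
    using \<open>D > 0\<close>
    by (simp_all add: assms(15-17) A_def B_def tanh_front_def fun_eq_iff flip: D_def)
  have rel_u: "\<beta>\<^sub>1 * A - \<alpha>\<^sub>2 * B = \<beta>\<^sub>1"
  proof -
    have "(\<beta>\<^sub>1 * A - \<alpha>\<^sub>2 * B) * D = \<beta>\<^sub>1 * (A * D) - \<alpha>\<^sub>2 * (B * D)"
      by algebra
    also have "\<dots> = \<beta>\<^sub>1 * D"
      unfolding AD BD unfolding D_def by algebra
    finally show ?thesis
      using \<open>D > 0\<close> by simp
  qed
  have rel_v: "B + \<kappa>\<^sub>2 * \<alpha>\<^sub>2 * A = 1"
  proof -
    have "(B + \<kappa>\<^sub>2 * \<alpha>\<^sub>2 * A) * D = B * D + \<kappa>\<^sub>2 * \<alpha>\<^sub>2 * (A * D)"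
      by algebra
    also have "\<dots> = 1 * D"
      unfolding AD BD unfolding D_def by algebra
    finally show ?thesis
      using \<open>D > 0\<close> by simp
  qed
  \<comment> \<open>\<open>E\<close> is the denominator in the formula for
    \<open>\<kappa>\<^sub>1\<close>, so the nondegeneracy hypothesis allows solving
    \<open>rel_\<kappa>\<close> for \<open>\<kappa>\<^sub>1\<close>.\<close>
  have E: "(\<alpha>\<^sub>3 * A - \<alpha>\<^sub>4 * B) * D = E"
  proof -
    have "(\<alpha>\<^sub>3 * A - \<alpha>\<^sub>4 * B) * D = \<alpha>\<^sub>3 * (A * D) - \<alpha>\<^sub>4 * (B * D)"
      by algebra
    also have "\<dots> = E"
      unfolding AD BD E_def by algebra
    finally show ?thesis .
  qed
  have rel_\<kappa>: "\<kappa>\<^sub>1 * (\<alpha>\<^sub>3 * A - \<alpha>\<^sub>4 * B) = 23 * B - \<kappa>\<^sub>2 * \<alpha>\<^sub>1 * A"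
  proof -
    have "\<kappa>\<^sub>1 * (\<alpha>\<^sub>3 * A - \<alpha>\<^sub>4 * B) * D = \<kappa>\<^sub>1 * E"
      using E by (simp add: mult.assoc)
    also have "\<dots> = 24 * \<alpha>\<^sub>2 * \<kappa>\<^sub>2 + 23 * \<beta>\<^sub>1 - (\<beta>\<^sub>1 - 24 + 24 * \<alpha>\<^sub>2) * \<beta>\<^sub>1 * \<kappa>\<^sub>2"
      using assms(9) by (simp add: assms(13) flip: E_def)
    also have "\<dots> = 23 * (B * D) - \<kappa>\<^sub>2 * \<alpha>\<^sub>1 * (A * D)"
      unfolding AD BD assms(12) by algebra
    also have "\<dots> = (23 * B - \<kappa>\<^sub>2 * \<alpha>\<^sub>1 * A) * D"
      by algebra
    finally show ?thesis
      using \<open>D > 0\<close> by simp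
  qed
  have rel_\<beta>: "\<beta>\<^sub>3 = \<alpha>\<^sub>3 * A - \<alpha>\<^sub>4 * B - 24"
  proof -
    have "\<beta>\<^sub>3 * D = (\<alpha>\<^sub>3 - \<alpha>\<^sub>4 - 24) * \<beta>\<^sub>1 - 24 * \<kappa>\<^sub>2 * \<alpha>\<^sub>2^2
        + (\<alpha>\<^sub>3 + \<alpha>\<^sub>4 * \<beta>\<^sub>1 * \<kappa>\<^sub>2) * \<alpha>\<^sub>2"
      using \<open>D > 0\<close> unfolding assms(14) by (simp flip: D_def)
    also have "\<dots> = E - 24 * D"
      unfolding E_def D_def by algebra
    also have "\<dots> = (\<alpha>\<^sub>3 * A - \<alpha>\<^sub>4 * B - 24) * D"
      unfolding E[symmetric] by algebra
    finally show ?thesis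
      using \<open>D > 0\<close> by simp
  qed
  have "time_deriv u t x = d\<^sub>1 * space_deriv (space_deriv u) t x
        + \<beta>\<^sub>1 * u t x * (1 - u t x) - \<alpha>\<^sub>1 * u t x * w t x + \<alpha>\<^sub>2 * u t x * v t x" for t x
  proof -
    \<comment> \<open>Here \<open>p\<close> stands for the front. The relation
      \<open>\<alpha>\<^sub>1 = \<beta>\<^sub>1 - 24\<close> settles the linear terms; the last
      summand collects the quadratic defect and vanishes by \<open>rel_u\<close>.\<close>
    have "24 * A * p * (1 - p) = \<beta>\<^sub>1 * (A * p) * (1 - A * p)
        - \<alpha>\<^sub>1 * (A * p) * (1 - p) + \<alpha>\<^sub>2 * (A * p) * (B * p)
        + A * p^2 * ((\<beta>\<^sub>1 * A - \<alpha>\<^sub>2 * B) - \<beta>\<^sub>1)" for p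
      unfolding assms(12) by algebra
    then show ?thesis
      unfolding u v w tanh_front_Fisher_equation assms(10) rel_u by simp
  qed
  moreover have "time_deriv v t x = space_deriv (space_deriv v) t x
        + v t x * (1 - v t x) + (\<kappa>\<^sub>1 * \<alpha>\<^sub>3 + \<kappa>\<^sub>2 * \<alpha>\<^sub>1) * u t x * w t x
        - (\<kappa>\<^sub>2 * \<alpha>\<^sub>2 * u t x + \<kappa>\<^sub>1 * \<alpha>\<^sub>4 * w t x) * v t x" for t x
  proof -
    \<comment> \<open>The coefficient of \<open>p\<close> is \<open>rel_\<kappa>\<close>, where 23 =
      24 - 1 accounts for the growth rate 1 of \<open>v\<close>; the coefficient of
      \<open>p^2\<close> needs \<open>rel_v\<close> as well.\<close>
    have "24 * B * p * (1 - p) = B * p * (1 - B * p)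
        + (\<kappa>\<^sub>1 * \<alpha>\<^sub>3 + \<kappa>\<^sub>2 * \<alpha>\<^sub>1) * (A * p) * (1 - p)
        - (\<kappa>\<^sub>2 * \<alpha>\<^sub>2 * (A * p) + \<kappa>\<^sub>1 * \<alpha>\<^sub>4 * (1 - p)) * (B * p)" for p
      using rel_v rel_\<kappa> by algebra
    then show ?thesis
      unfolding u v w tanh_front_Fisher_equation by simp
  qed
  moreover have "time_deriv w t x = d\<^sub>3 * space_deriv (space_deriv w) t x
        + \<beta>\<^sub>3 * w t x * (1 - w t x) - \<alpha>\<^sub>3 * u t x * w t x + \<alpha>\<^sub>4 * v t x * w t x" for t x
  proof -
    \<comment> \<open>Since 1 - \<open>w\<close> is the front itself, every term carries the factor
      \<open>p * (1 - p)\<close>, leaving one relation between constants.\<close>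
    have "- 24 * p * (1 - p) = \<beta>\<^sub>3 * (1 - p) * p
        - \<alpha>\<^sub>3 * (A * p) * (1 - p) + \<alpha>\<^sub>4 * (B * p) * (1 - p)" for p
      unfolding rel_\<beta> by algebra
    then show ?thesis
      unfolding u v w tanh_front_Fisher_equation assms(11) by simp
  qed
  moreover have "classically_regular u" "classically_regular v" "classically_regular w"
    unfolding u v w by (rule classically_regular_tanh_front)+
  ultimately show ?thesis
    by blast
qed

end
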